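(* Let $k$ be a commutative ring with identity, $A$ a pre-Lie $k$-algebra, and $I,J$ two ideals of $A$. The Smith commutator $[I,J]_S$ of $I$ and $J$ is the ideal of $A$ generated by the subset $\{\,ij,\ ji\mid i\in I,\ j\in J\,\}$. Hence $[I,J]_H=[I,J]_S$, where $[I,J]_H$ is the Huq commutator of $I$ and $J$.
   Context: A $k$-algebra is a $k$-module with a $k$-bilinear multiplication (not necessarily associative). A pre-Lie $k$-algebra is a $k$-algebra $A$ with $(xy)z-x(yz)=(yx)z-y(xz)$ for all $x,y,z\in A$. Pre-Lie algebra morphisms are $k$-linear multiplicative mappings. An ideal of $A$ is a $k$-submodule $N$ with $xn\in N$ and $nx\in N$ for all $x\in A$, $n\in N$; the ideal generated by a subset is the intersection of all ideals containing it. The Smith commutator $[I,J]_S$ is the smallest ideal $K$ of $A$ for which the mapping $$\{(x,y,z)\in A^3\mid x\equiv y \pmod I,\ y\equiv z\pmod J\}\to A/K,\qquad (x,y,z)\mapsto x-y+z+K,$$ is a pre-Lie algebra morphism (the domain being a subalgebra of $A\times A\times A$ with componentwise operations). The Huq commutator $[I,J]_H$ is the smallest ideal $K$ of $A$ for which the mapping $I\times J\to A/K$, $(i,j)\mapsto i+j+K$, is a pre-Lie algebra morphism ($I\times J$ with componentwise operations). *)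

theory Defs
  imports "HOL-Algebra.QuotRing" "HOL-Algebra.Module"
begin

text \<open>
  The record type \<^typ>\<open>('k, 'a) module\<close> already carries a multiplication, which
  \<^locale>\<open>module\<close> leaves unconstrained; it is used here as the (nonassociative) product.
  The record field for a multiplicative unit has no meaning below and is never constrained.
\<close>

locale pre_lie_algebra = module R A
  for R :: "('k, 'r) ring_scheme" (structure) and A :: "('k, 'a, 'm) module_scheme" (structure) +
  assumes mult_closed:
      "\<lbrakk> x \<in> carrier A; y \<in> carrier A \<rbrakk> \<Longrightarrow> x \<otimes>\<^bsub>A\<^esub> y \<in> carrier A"
    and mult_l_distr:
      "\<lbrakk> x \<in> carrier A; y \<in> carrier A; z \<in> carrier A \<rbrakk> \<Longrightarrow>
        (x \<oplus>\<^bsub>A\<^esub> y) \<otimes>\<^bsub>A\<^esub> z = x \<otimes>\<^bsub>A\<^esub> z \<oplus>\<^bsub>A\<^esub> y \<otimes>\<^bsub>A\<^esub> z"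
    and mult_r_distr:
      "\<lbrakk> x \<in> carrier A; y \<in> carrier A; z \<in> carrier A \<rbrakk> \<Longrightarrow>
        z \<otimes>\<^bsub>A\<^esub> (x \<oplus>\<^bsub>A\<^esub> y) = z \<otimes>\<^bsub>A\<^esub> x \<oplus>\<^bsub>A\<^esub> z \<otimes>\<^bsub>A\<^esub> y"
    and mult_l_smult:
      "\<lbrakk> a \<in> carrier R; x \<in> carrier A; y \<in> carrier A \<rbrakk> \<Longrightarrow>
        (a \<odot>\<^bsub>A\<^esub> x) \<otimes>\<^bsub>A\<^esub> y = a \<odot>\<^bsub>A\<^esub> (x \<otimes>\<^bsub>A\<^esub> y)"
    and mult_r_smult:
      "\<lbrakk> a \<in> carrier R; x \<in> carrier A; y \<in> carrier A \<rbrakk> \<Longrightarrow>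
        x \<otimes>\<^bsub>A\<^esub> (a \<odot>\<^bsub>A\<^esub> y) = a \<odot>\<^bsub>A\<^esub> (x \<otimes>\<^bsub>A\<^esub> y)"
    and pre_lie:
      "\<lbrakk> x \<in> carrier A; y \<in> carrier A; z \<in> carrier A \<rbrakk> \<Longrightarrow>
        (x \<otimes>\<^bsub>A\<^esub> y) \<otimes>\<^bsub>A\<^esub> z \<ominus>\<^bsub>A\<^esub> x \<otimes>\<^bsub>A\<^esub> (y \<otimes>\<^bsub>A\<^esub> z) =
        (y \<otimes>\<^bsub>A\<^esub> x) \<otimes>\<^bsub>A\<^esub> z \<ominus>\<^bsub>A\<^esub> y \<otimes>\<^bsub>A\<^esub> (x \<otimes>\<^bsub>A\<^esub> z)"

definition pre_lie_ideal ::
    "('k, 'r) ring_scheme \<Rightarrow> ('k, 'a, 'm) module_scheme \<Rightarrow> 'a set \<Rightarrow> bool" where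
  "pre_lie_ideal R A N \<longleftrightarrow> submodule N R A \<and>
    (\<forall>x\<in>carrier A. \<forall>n\<in>N. x \<otimes>\<^bsub>A\<^esub> n \<in> N \<and> n \<otimes>\<^bsub>A\<^esub> x \<in> N)"

definition ideal_generated ::
    "('k, 'r) ring_scheme \<Rightarrow> ('k, 'a, 'm) module_scheme \<Rightarrow> 'a set \<Rightarrow> 'a set" where
  "ideal_generated R A S = \<Inter>{N. pre_lie_ideal R A N \<and> S \<subseteq> N}"

definition pre_lie_morphism ::
    "('k, 'r) ring_scheme \<Rightarrow> ('k, 'a, 'm) module_scheme \<Rightarrow> ('k, 'b, 'n) module_scheme
      \<Rightarrow> ('a \<Rightarrow> 'b) \<Rightarrow> bool" where
  "pre_lie_morphism R A B f \<longleftrightarrow>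
    f \<in> hom (add_monoid A) (add_monoid B) \<and>
    (\<forall>a\<in>carrier R. \<forall>x\<in>carrier A. f (a \<odot>\<^bsub>A\<^esub> x) = a \<odot>\<^bsub>B\<^esub> f x) \<and>
    f \<in> hom A B"

definition alg_prod ::
    "('k, 'a, 'm) module_scheme \<Rightarrow> ('k, 'b, 'n) module_scheme \<Rightarrow> ('k, 'a \<times> 'b) module"
    (infixr \<open>\<times>\<^sub>a\<close> 80) where
  "A \<times>\<^sub>a B =
    \<lparr>carrier = carrier A \<times> carrier B,
     mult = (\<lambda>(x, y) (x', y'). (x \<otimes>\<^bsub>A\<^esub> x', y \<otimes>\<^bsub>B\<^esub> y')),
     one = (\<one>\<^bsub>A\<^esub>, \<one>\<^bsub>B\<^esub>),
     zero = (\<zero>\<^bsub>A\<^esub>, \<zero>\<^bsub>B\<^esub>),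
     add = (\<lambda>(x, y) (x', y'). (x \<oplus>\<^bsub>A\<^esub> x', y \<oplus>\<^bsub>B\<^esub> y')),
     smult = (\<lambda>a (x, y). (a \<odot>\<^bsub>A\<^esub> x, a \<odot>\<^bsub>B\<^esub> y))\<rparr>"

text \<open>
  The ring part is that of \<^const>\<open>FactRing\<close>, whose definition presupposes neither
  associativity nor a unit; scalar multiplication is defined in the style of
  \<^const>\<open>rcoset_mult\<close>.
\<close>

definition alg_quot ::
    "('k, 'a, 'm) module_scheme \<Rightarrow> 'a set \<Rightarrow> ('k, 'a set) module" (infixl \<open>'/\<^sub>a\<close> 75) where
  "A /\<^sub>a K =
    \<lparr>carrier = a_rcosets\<^bsub>A\<^esub> K, mult = rcoset_mult A K,
     one = K +>\<^bsub>A\<^esub> \<one>\<^bsub>A\<^esub>, zero = K, add = set_add A,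
     smult = (\<lambda>a X. \<Union>x\<in>X. K +>\<^bsub>A\<^esub> (a \<odot>\<^bsub>A\<^esub> x))\<rparr>"

definition smith_domain ::
    "('k, 'a, 'm) module_scheme \<Rightarrow> 'a set \<Rightarrow> 'a set \<Rightarrow> ('k, 'a \<times> 'a \<times> 'a) module" where
  "smith_domain A I J = (A \<times>\<^sub>a A \<times>\<^sub>a A)\<lparr>carrier :=
    {(x, y, z). x \<in> carrier A \<and> y \<in> carrier A \<and> z \<in> carrier A \<and>
      x \<ominus>\<^bsub>A\<^esub> y \<in> I \<and> y \<ominus>\<^bsub>A\<^esub> z \<in> J}\<rparr>"

definition smith_condition ::
    "('k, 'r) ring_scheme \<Rightarrow> ('k, 'a, 'm) module_scheme \<Rightarrow> 'a set \<Rightarrow> 'a set \<Rightarrow> 'a set \<Rightarrow> bool" where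
  "smith_condition R A I J K \<longleftrightarrow> pre_lie_ideal R A K \<and>
    pre_lie_morphism R (smith_domain A I J) (A /\<^sub>a K)
      (\<lambda>(x, y, z). K +>\<^bsub>A\<^esub> ((x \<ominus>\<^bsub>A\<^esub> y) \<oplus>\<^bsub>A\<^esub> z))"

definition huq_condition ::
    "('k, 'r) ring_scheme \<Rightarrow> ('k, 'a, 'm) module_scheme \<Rightarrow> 'a set \<Rightarrow> 'a set \<Rightarrow> 'a set \<Rightarrow> bool" where
  "huq_condition R A I J K \<longleftrightarrow> pre_lie_ideal R A K \<and>
    pre_lie_morphism R (A\<lparr>carrier := I\<rparr> \<times>\<^sub>a A\<lparr>carrier := J\<rparr>) (A /\<^sub>a K)
      (\<lambda>(i, j). K +>\<^bsub>A\<^esub> (i \<oplus>\<^bsub>A\<^esub> j))"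

text \<open>
  \<^const>\<open>Least\<close> refers to inclusion of sets. That the least elements exist is shown in
  \<open>smith_commutator_least\<close> and \<open>huq_commutator_least\<close> below.
\<close>

definition smith_commutator ::
    "('k, 'r) ring_scheme \<Rightarrow> ('k, 'a, 'm) module_scheme \<Rightarrow> 'a set \<Rightarrow> 'a set \<Rightarrow> 'a set" where
  "smith_commutator R A I J = (LEAST K. smith_condition R A I J K)"

definition huq_commutator ::
    "('k, 'r) ring_scheme \<Rightarrow> ('k, 'a, 'm) module_scheme \<Rightarrow> 'a set \<Rightarrow> 'a set \<Rightarrow> 'a set" where
  "huq_commutator R A I J = (LEAST K. huq_condition R A I J K)"

context pre_lie_algebra
begin

lemma ideal_subset: "pre_lie_ideal R A K \<Longrightarrow> K \<subseteq> carrier A"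
  unfolding pre_lie_ideal_def using submoduleE(1) by blast

lemma ideal_closed:
  assumes "pre_lie_ideal R A K"
  shows "\<lbrakk> x \<in> K; y \<in> K \<rbrakk> \<Longrightarrow> x \<oplus>\<^bsub>A\<^esub> y \<in> K"
    and "x \<in> K \<Longrightarrow> \<ominus>\<^bsub>A\<^esub> x \<in> K"
    and "\<lbrakk> a \<in> carrier R; x \<in> K \<rbrakk> \<Longrightarrow> a \<odot>\<^bsub>A\<^esub> x \<in> K"
    and "\<lbrakk> x \<in> carrier A; y \<in> K \<rbrakk> \<Longrightarrow> x \<otimes>\<^bsub>A\<^esub> y \<in> K"
    and "\<lbrakk> x \<in> K; y \<in> carrier A \<rbrakk> \<Longrightarrow> x \<otimes>\<^bsub>A\<^esub> y \<in> K"
proof -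
  have K: "submodule K R A" using assms by (simp add: pre_lie_ideal_def)
  show "\<lbrakk> x \<in> K; y \<in> K \<rbrakk> \<Longrightarrow> x \<oplus>\<^bsub>A\<^esub> y \<in> K" by (rule submoduleE(5)[OF K])
  show "x \<in> K \<Longrightarrow> \<ominus>\<^bsub>A\<^esub> x \<in> K" by (rule submoduleE(3)[OF K])
  show "\<lbrakk> a \<in> carrier R; x \<in> K \<rbrakk> \<Longrightarrow> a \<odot>\<^bsub>A\<^esub> x \<in> K" by (rule submoduleE(4)[OF K])
  show "\<lbrakk> x \<in> carrier A; y \<in> K \<rbrakk> \<Longrightarrow> x \<otimes>\<^bsub>A\<^esub> y \<in> K"
    and "\<lbrakk> x \<in> K; y \<in> carrier A \<rbrakk> \<Longrightarrow> x \<otimes>\<^bsub>A\<^esub> y \<in> K"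
    using assms by (simp_all add: pre_lie_ideal_def)
qed

lemma ideal_zero: "pre_lie_ideal R A K \<Longrightarrow> \<zero>\<^bsub>A\<^esub> \<in> K"
  unfolding pre_lie_ideal_def submodule_def using subgroup.one_closed by fastforce

lemma ideal_subgroup: "pre_lie_ideal R A K \<Longrightarrow> additive_subgroup K A"
  by (simp add: pre_lie_ideal_def submodule_def additive_subgroup_def)

lemma ideal_abelian: "pre_lie_ideal R A K \<Longrightarrow> abelian_subgroup K A"
  by (simp add: abelian_subgroupI3 ideal_subgroup M.abelian_group_axioms)

lemma mem_coset: "u \<in> K +>\<^bsub>A\<^esub> x \<longleftrightarrow> (\<exists>k\<in>K. u = k \<oplus>\<^bsub>A\<^esub> x)"
  by (auto simp: a_r_coset_def r_coset_def)

lemma coset_eq_iff: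
  assumes K: "pre_lie_ideal R A K" and x: "x \<in> carrier A" and y: "y \<in> carrier A"
  shows "K +>\<^bsub>A\<^esub> x = K +>\<^bsub>A\<^esub> y \<longleftrightarrow> x \<ominus>\<^bsub>A\<^esub> y \<in> K"
proof -
  interpret S: abelian_subgroup K A by (rule ideal_abelian[OF K])
  have "x \<in> K +>\<^bsub>A\<^esub> y \<longleftrightarrow> x \<ominus>\<^bsub>A\<^esub> y \<in> K"
    using S.a_rcos_module[OF y x] by (simp add: a_minus_def)
  moreover have "K +>\<^bsub>A\<^esub> x = K +>\<^bsub>A\<^esub> y \<longleftrightarrow> x \<in> K +>\<^bsub>A\<^esub> y"
    using S.a_repr_independence'[OF _ y] S.a_rcos_self[OF x] by metis
  ultimately show ?thesis by simp
qed

lemma quot_add: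
  assumes K: "pre_lie_ideal R A K" and "x \<in> carrier A" "y \<in> carrier A"
  shows "(K +>\<^bsub>A\<^esub> x) \<oplus>\<^bsub>A /\<^sub>a K\<^esub> (K +>\<^bsub>A\<^esub> y) = K +>\<^bsub>A\<^esub> (x \<oplus>\<^bsub>A\<^esub> y)"
  using abelian_subgroup.a_rcos_sum[OF ideal_abelian[OF K]] assms by (simp add: alg_quot_def)

lemma quot_mult:
  assumes K: "pre_lie_ideal R A K" and x: "x \<in> carrier A" and y: "y \<in> carrier A"
  shows "(K +>\<^bsub>A\<^esub> x) \<otimes>\<^bsub>A /\<^sub>a K\<^esub> (K +>\<^bsub>A\<^esub> y) = K +>\<^bsub>A\<^esub> (x \<otimes>\<^bsub>A\<^esub> y)"
proof -
  interpret S: abelian_subgroup K A by (rule ideal_abelian[OF K])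
  have *: "K +>\<^bsub>A\<^esub> (u \<otimes>\<^bsub>A\<^esub> v) = K +>\<^bsub>A\<^esub> (x \<otimes>\<^bsub>A\<^esub> y)"
    if u: "u \<in> K +>\<^bsub>A\<^esub> x" and v: "v \<in> K +>\<^bsub>A\<^esub> y" for u v
  proof -
    obtain k where k: "k \<in> K" "u = k \<oplus>\<^bsub>A\<^esub> x" using u mem_coset by auto
    obtain l where l: "l \<in> K" "v = l \<oplus>\<^bsub>A\<^esub> y" using v mem_coset by auto
    have c: "k \<in> carrier A" "l \<in> carrier A" using k l ideal_subset[OF K] by auto
    have "u \<otimes>\<^bsub>A\<^esub> v = (k \<otimes>\<^bsub>A\<^esub> (l \<oplus>\<^bsub>A\<^esub> y) \<oplus>\<^bsub>A\<^esub> x \<otimes>\<^bsub>A\<^esub> l) \<oplus>\<^bsub>A\<^esub> x \<otimes>\<^bsub>A\<^esub> y"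
      using c x y k l by (simp add: mult_l_distr mult_r_distr mult_closed M.a_ac)
    moreover have "k \<otimes>\<^bsub>A\<^esub> (l \<oplus>\<^bsub>A\<^esub> y) \<oplus>\<^bsub>A\<^esub> x \<otimes>\<^bsub>A\<^esub> l \<in> K"
      using k l c x y by (simp add: ideal_closed[OF K])
    ultimately have "u \<otimes>\<^bsub>A\<^esub> v \<in> K +>\<^bsub>A\<^esub> (x \<otimes>\<^bsub>A\<^esub> y)" using mem_coset by blast
    then show ?thesis using S.a_repr_independence' mult_closed x y by metis
  qed
  have "x \<in> K +>\<^bsub>A\<^esub> x" "y \<in> K +>\<^bsub>A\<^esub> y" using S.a_rcos_self x y by auto
  then have "(\<Union>u\<in>K +>\<^bsub>A\<^esub> x. \<Union>v\<in>K +>\<^bsub>A\<^esub> y. K +>\<^bsub>A\<^esub> (x \<otimes>\<^bsub>A\<^esub> y)) = K +>\<^bsub>A\<^esub> (x \<otimes>\<^bsub>A\<^esub> y)"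
    by blast
  moreover have "(\<Union>u\<in>K +>\<^bsub>A\<^esub> x. \<Union>v\<in>K +>\<^bsub>A\<^esub> y. K +>\<^bsub>A\<^esub> (u \<otimes>\<^bsub>A\<^esub> v)) =
      (\<Union>u\<in>K +>\<^bsub>A\<^esub> x. \<Union>v\<in>K +>\<^bsub>A\<^esub> y. K +>\<^bsub>A\<^esub> (x \<otimes>\<^bsub>A\<^esub> y))"
    by (intro SUP_cong refl *)
  ultimately show ?thesis by (simp only: alg_quot_def rcoset_mult_def monoid.simps)
qed

lemma quot_smult:
  assumes K: "pre_lie_ideal R A K" and x: "x \<in> carrier A" and a: "a \<in> carrier R"
  shows "a \<odot>\<^bsub>A /\<^sub>a K\<^esub> (K +>\<^bsub>A\<^esub> x) = K +>\<^bsub>A\<^esub> (a \<odot>\<^bsub>A\<^esub> x)"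
proof -
  interpret S: abelian_subgroup K A by (rule ideal_abelian[OF K])
  have *: "K +>\<^bsub>A\<^esub> (a \<odot>\<^bsub>A\<^esub> u) = K +>\<^bsub>A\<^esub> (a \<odot>\<^bsub>A\<^esub> x)" if u: "u \<in> K +>\<^bsub>A\<^esub> x" for u
  proof -
    obtain k where k: "k \<in> K" "u = k \<oplus>\<^bsub>A\<^esub> x" using u mem_coset by auto
    have c: "k \<in> carrier A" using k ideal_subset[OF K] by auto
    have "a \<odot>\<^bsub>A\<^esub> u = a \<odot>\<^bsub>A\<^esub> k \<oplus>\<^bsub>A\<^esub> a \<odot>\<^bsub>A\<^esub> x"
      using c x a k by (simp add: smult_r_distr)
    moreover have "a \<odot>\<^bsub>A\<^esub> k \<in> K"
      using k(1) a by (simp add: ideal_closed[OF K])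
    ultimately have "a \<odot>\<^bsub>A\<^esub> u \<in> K +>\<^bsub>A\<^esub> (a \<odot>\<^bsub>A\<^esub> x)" using mem_coset by blast
    then show ?thesis using S.a_repr_independence' smult_closed x a by metis
  qed
  have "x \<in> K +>\<^bsub>A\<^esub> x" using S.a_rcos_self x by auto
  then have "(\<Union>u\<in>K +>\<^bsub>A\<^esub> x. K +>\<^bsub>A\<^esub> (a \<odot>\<^bsub>A\<^esub> x)) = K +>\<^bsub>A\<^esub> (a \<odot>\<^bsub>A\<^esub> x)"
    by blast
  moreover have "(\<Union>u\<in>K +>\<^bsub>A\<^esub> x. K +>\<^bsub>A\<^esub> (a \<odot>\<^bsub>A\<^esub> u)) = (\<Union>u\<in>K +>\<^bsub>A\<^esub> x. K +>\<^bsub>A\<^esub> (a \<odot>\<^bsub>A\<^esub> x))"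
    by (intro SUP_cong refl *)
  ultimately show ?thesis by (simp only: alg_quot_def module.simps)
qed

lemma carrier_ideal: "pre_lie_ideal R A (carrier A)"
  by (simp add: pre_lie_ideal_def carrier_is_submodule mult_closed)

lemma Inter_ideal:
  assumes "\<And>K. K \<in> F \<Longrightarrow> pre_lie_ideal R A K" and "F \<noteq> {}"
  shows "pre_lie_ideal R A (\<Inter>F)"
  unfolding pre_lie_ideal_def
proof (intro conjI ballI submoduleI)
  show "\<Inter>F \<subseteq> carrier A" using assms ideal_subset by blast
  show "\<zero>\<^bsub>A\<^esub> \<in> \<Inter>F" using assms ideal_zero by blast
qed (simp_all add: assms ideal_closed)

lemma morphism_quot_iff:
  assumes K: "pre_lie_ideal R A K" and g: "g \<in> carrier D \<rightarrow> carrier A"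
    and add: "\<And>s t. \<lbrakk> s \<in> carrier D; t \<in> carrier D \<rbrakk> \<Longrightarrow> s \<oplus>\<^bsub>D\<^esub> t \<in> carrier D"
    and mult: "\<And>s t. \<lbrakk> s \<in> carrier D; t \<in> carrier D \<rbrakk> \<Longrightarrow> s \<otimes>\<^bsub>D\<^esub> t \<in> carrier D"
    and smult: "\<And>a t. \<lbrakk> a \<in> carrier R; t \<in> carrier D \<rbrakk> \<Longrightarrow> a \<odot>\<^bsub>D\<^esub> t \<in> carrier D"
  shows "pre_lie_morphism R D (A /\<^sub>a K) (\<lambda>t. K +>\<^bsub>A\<^esub> g t) \<longleftrightarrow>
    (\<forall>s\<in>carrier D. \<forall>t\<in>carrier D. g (s \<oplus>\<^bsub>D\<^esub> t) \<ominus>\<^bsub>A\<^esub> (g s \<oplus>\<^bsub>A\<^esub> g t) \<in> K) \<and>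
    (\<forall>a\<in>carrier R. \<forall>t\<in>carrier D. g (a \<odot>\<^bsub>D\<^esub> t) \<ominus>\<^bsub>A\<^esub> (a \<odot>\<^bsub>A\<^esub> g t) \<in> K) \<and>
    (\<forall>s\<in>carrier D. \<forall>t\<in>carrier D. g (s \<otimes>\<^bsub>D\<^esub> t) \<ominus>\<^bsub>A\<^esub> (g s \<otimes>\<^bsub>A\<^esub> g t) \<in> K)"
proof -
  have gc: "g t \<in> carrier A" if "t \<in> carrier D" for t using g that by auto
  have cos: "K +>\<^bsub>A\<^esub> x \<in> carrier (A /\<^sub>a K)" if "x \<in> carrier A" for x
    using that by (auto simp: alg_quot_def A_RCOSETS_def RCOSETS_def a_r_coset_def)
  show ?thesis
    unfolding pre_lie_morphism_def hom_def
    by (auto simp: gc cos quot_add[OF K] quot_mult[OF K] quot_smult[OF K] coset_eq_iff[OF K]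
        add mult smult mult_closed)
qed

lemma smith_domain_closed:
  assumes I: "pre_lie_ideal R A I" and J: "pre_lie_ideal R A J"
  defines "D \<equiv> smith_domain A I J"
  shows "\<lbrakk> s \<in> carrier D; t \<in> carrier D \<rbrakk> \<Longrightarrow> s \<oplus>\<^bsub>D\<^esub> t \<in> carrier D"
    and "\<lbrakk> s \<in> carrier D; t \<in> carrier D \<rbrakk> \<Longrightarrow> s \<otimes>\<^bsub>D\<^esub> t \<in> carrier D"
    and "\<lbrakk> a \<in> carrier R; t \<in> carrier D \<rbrakk> \<Longrightarrow> a \<odot>\<^bsub>D\<^esub> t \<in> carrier D"
proof -
  have a: "(x \<oplus>\<^bsub>A\<^esub> x') \<ominus>\<^bsub>A\<^esub> (y \<oplus>\<^bsub>A\<^esub> y') \<in> N"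
    and m: "(x \<otimes>\<^bsub>A\<^esub> x') \<ominus>\<^bsub>A\<^esub> (y \<otimes>\<^bsub>A\<^esub> y') \<in> N"
    if N: "pre_lie_ideal R A N" and c: "x \<in> carrier A" "x' \<in> carrier A" "y \<in> carrier A" "y' \<in> carrier A"
      and d: "x \<ominus>\<^bsub>A\<^esub> y \<in> N" "x' \<ominus>\<^bsub>A\<^esub> y' \<in> N" for N x x' y y'
  proof -
    have e: "N +>\<^bsub>A\<^esub> x = N +>\<^bsub>A\<^esub> y" "N +>\<^bsub>A\<^esub> x' = N +>\<^bsub>A\<^esub> y'"
      using d c by (simp_all add: coset_eq_iff[OF N])
    show "(x \<oplus>\<^bsub>A\<^esub> x') \<ominus>\<^bsub>A\<^esub> (y \<oplus>\<^bsub>A\<^esub> y') \<in> N"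
      using quot_add[OF N c(1,2)] quot_add[OF N c(3,4)] e c by (simp flip: coset_eq_iff[OF N])
    show "(x \<otimes>\<^bsub>A\<^esub> x') \<ominus>\<^bsub>A\<^esub> (y \<otimes>\<^bsub>A\<^esub> y') \<in> N"
      using quot_mult[OF N c(1,2)] quot_mult[OF N c(3,4)] e c mult_closed by (simp flip: coset_eq_iff[OF N])
  qed
  have s: "(b \<odot>\<^bsub>A\<^esub> x) \<ominus>\<^bsub>A\<^esub> (b \<odot>\<^bsub>A\<^esub> y) \<in> N"
    if N: "pre_lie_ideal R A N" and c: "x \<in> carrier A" "y \<in> carrier A" "b \<in> carrier R"
      and d: "x \<ominus>\<^bsub>A\<^esub> y \<in> N" for N x y b
  proof -
    have e: "N +>\<^bsub>A\<^esub> x = N +>\<^bsub>A\<^esub> y"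
      using d c by (simp add: coset_eq_iff[OF N])
    show ?thesis
      using quot_smult[OF N c(1,3)] quot_smult[OF N c(2,3)] e c by (simp flip: coset_eq_iff[OF N])
  qed
  show "\<lbrakk> s \<in> carrier D; t \<in> carrier D \<rbrakk> \<Longrightarrow> s \<oplus>\<^bsub>D\<^esub> t \<in> carrier D"
    by (auto simp: D_def smith_domain_def alg_prod_def intro: a[OF I] a[OF J])
  show "\<lbrakk> s \<in> carrier D; t \<in> carrier D \<rbrakk> \<Longrightarrow> s \<otimes>\<^bsub>D\<^esub> t \<in> carrier D"
    by (auto simp: D_def smith_domain_def alg_prod_def mult_closed intro: m[OF I] m[OF J])
  show "\<lbrakk> a \<in> carrier R; t \<in> carrier D \<rbrakk> \<Longrightarrow> a \<odot>\<^bsub>D\<^esub> t \<in> carrier D"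
    by (auto simp: D_def smith_domain_def alg_prod_def intro: s[OF I] s[OF J])
qed

lemma huq_domain_closed:
  assumes I: "pre_lie_ideal R A I" and J: "pre_lie_ideal R A J"
  defines "D \<equiv> A\<lparr>carrier := I\<rparr> \<times>\<^sub>a A\<lparr>carrier := J\<rparr>"
  shows "\<lbrakk> s \<in> carrier D; t \<in> carrier D \<rbrakk> \<Longrightarrow> s \<oplus>\<^bsub>D\<^esub> t \<in> carrier D"
    and "\<lbrakk> s \<in> carrier D; t \<in> carrier D \<rbrakk> \<Longrightarrow> s \<otimes>\<^bsub>D\<^esub> t \<in> carrier D"
    and "\<lbrakk> a \<in> carrier R; t \<in> carrier D \<rbrakk> \<Longrightarrow> a \<odot>\<^bsub>D\<^esub> t \<in> carrier D"
proof -
  have N: "\<lbrakk> x \<in> N; y \<in> N \<rbrakk> \<Longrightarrow> x \<oplus>\<^bsub>A\<^esub> y \<in> N" "\<lbrakk> x \<in> N; y \<in> N \<rbrakk> \<Longrightarrow> x \<otimes>\<^bsub>A\<^esub> y \<in> N"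
    "\<lbrakk> b \<in> carrier R; x \<in> N \<rbrakk> \<Longrightarrow> b \<odot>\<^bsub>A\<^esub> x \<in> N" if "pre_lie_ideal R A N" for N x y b
    using ideal_subset[OF that] by (auto intro: ideal_closed[OF that])
  note NI = N[OF I] and NJ = N[OF J]
  show "\<lbrakk> s \<in> carrier D; t \<in> carrier D \<rbrakk> \<Longrightarrow> s \<oplus>\<^bsub>D\<^esub> t \<in> carrier D"
    by (auto simp: D_def alg_prod_def NI NJ)
  show "\<lbrakk> s \<in> carrier D; t \<in> carrier D \<rbrakk> \<Longrightarrow> s \<otimes>\<^bsub>D\<^esub> t \<in> carrier D"
    by (auto simp: D_def alg_prod_def NI NJ)
  show "\<lbrakk> a \<in> carrier R; t \<in> carrier D \<rbrakk> \<Longrightarrow> a \<odot>\<^bsub>D\<^esub> t \<in> carrier D"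
    by (auto simp: D_def alg_prod_def NI NJ)
qed

lemma least_morphism_ideal:
  assumes g: "g \<in> carrier D \<rightarrow> carrier A"
    and add: "\<And>s t. \<lbrakk> s \<in> carrier D; t \<in> carrier D \<rbrakk> \<Longrightarrow> s \<oplus>\<^bsub>D\<^esub> t \<in> carrier D"
    and mult: "\<And>s t. \<lbrakk> s \<in> carrier D; t \<in> carrier D \<rbrakk> \<Longrightarrow> s \<otimes>\<^bsub>D\<^esub> t \<in> carrier D"
    and smult: "\<And>a t. \<lbrakk> a \<in> carrier R; t \<in> carrier D \<rbrakk> \<Longrightarrow> a \<odot>\<^bsub>D\<^esub> t \<in> carrier D"
  defines "P \<equiv> \<lambda>K. pre_lie_ideal R A K \<and> pre_lie_morphism R D (A /\<^sub>a K) (\<lambda>t. K +>\<^bsub>A\<^esub> g t)"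
  shows "P (Least P)" and "P K \<Longrightarrow> Least P \<subseteq> K"
proof -
  define Q where "Q = (\<lambda>K.
    (\<forall>s\<in>carrier D. \<forall>t\<in>carrier D. g (s \<oplus>\<^bsub>D\<^esub> t) \<ominus>\<^bsub>A\<^esub> (g s \<oplus>\<^bsub>A\<^esub> g t) \<in> K) \<and>
    (\<forall>a\<in>carrier R. \<forall>t\<in>carrier D. g (a \<odot>\<^bsub>D\<^esub> t) \<ominus>\<^bsub>A\<^esub> (a \<odot>\<^bsub>A\<^esub> g t) \<in> K) \<and>
    (\<forall>s\<in>carrier D. \<forall>t\<in>carrier D. g (s \<otimes>\<^bsub>D\<^esub> t) \<ominus>\<^bsub>A\<^esub> (g s \<otimes>\<^bsub>A\<^esub> g t) \<in> K))"
  have P: "P K \<longleftrightarrow> pre_lie_ideal R A K \<and> Q K" for K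
  proof (cases "pre_lie_ideal R A K")
    case True
    have "pre_lie_morphism R D (A /\<^sub>a K) (\<lambda>t. K +>\<^bsub>A\<^esub> g t) \<longleftrightarrow> Q K"
      unfolding Q_def by (rule morphism_quot_iff[OF True g]) (fact add mult smult)+
    then show ?thesis by (simp add: P_def)
  qed (simp add: P_def)
  have gc: "g t \<in> carrier A" if "t \<in> carrier D" for t using g that by auto
  have top: "P (carrier A)"
    by (simp add: P Q_def carrier_ideal gc add mult smult mult_closed)
  have "pre_lie_ideal R A (\<Inter>(Collect P))"
    by (rule Inter_ideal) (use top P in auto)
  moreover have "Q (\<Inter>(Collect P))"
    unfolding Q_def by (simp add: P) (simp add: Q_def)
  ultimately have inter: "P (\<Inter>(Collect P))"
    by (simp only: P simp_thms)
  then have "Least P = \<Inter>(Collect P)"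
    by (rule Least_equality) auto
  with inter have "P (Least P) \<and> (\<forall>K. P K \<longrightarrow> Least P \<subseteq> K)"
    by auto
  then show "P (Least P)" and "P K \<Longrightarrow> Least P \<subseteq> K" by auto
qed

lemma smith_commutator_least:
  assumes I: "pre_lie_ideal R A I" and J: "pre_lie_ideal R A J"
  shows "smith_condition R A I J (smith_commutator R A I J)"
    and "smith_condition R A I J K \<Longrightarrow> smith_commutator R A I J \<subseteq> K"
proof -
  define g where "g = (\<lambda>(x, y, z). (x \<ominus>\<^bsub>A\<^esub> y) \<oplus>\<^bsub>A\<^esub> z)"
  have g: "g \<in> carrier (smith_domain A I J) \<rightarrow> carrier A"
    by (auto simp: g_def smith_domain_def)
  have eq: "smith_condition R A I J = (\<lambda>K. pre_lie_ideal R A K \<and>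
      pre_lie_morphism R (smith_domain A I J) (A /\<^sub>a K) (\<lambda>t. K +>\<^bsub>A\<^esub> g t))"
    by (simp add: fun_eq_iff smith_condition_def g_def case_prod_unfold)
  note L = least_morphism_ideal[OF g smith_domain_closed[OF I J]]
  show "smith_condition R A I J (smith_commutator R A I J)"
    unfolding smith_commutator_def eq by (rule L(1))
  show "smith_condition R A I J K \<Longrightarrow> smith_commutator R A I J \<subseteq> K"
    unfolding smith_commutator_def eq by (rule L(2))
qed

lemma huq_commutator_least:
  assumes I: "pre_lie_ideal R A I" and J: "pre_lie_ideal R A J"
  shows "huq_condition R A I J (huq_commutator R A I J)"
    and "huq_condition R A I J K \<Longrightarrow> huq_commutator R A I J \<subseteq> K"
proof -
  define g where "g = (\<lambda>(i, j). i \<oplus>\<^bsub>A\<^esub> j)"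
  have g: "g \<in> carrier (A\<lparr>carrier := I\<rparr> \<times>\<^sub>a A\<lparr>carrier := J\<rparr>) \<rightarrow> carrier A"
    using ideal_subset[OF I] ideal_subset[OF J] by (auto simp: g_def alg_prod_def)
  have eq: "huq_condition R A I J = (\<lambda>K. pre_lie_ideal R A K \<and>
      pre_lie_morphism R (A\<lparr>carrier := I\<rparr> \<times>\<^sub>a A\<lparr>carrier := J\<rparr>) (A /\<^sub>a K) (\<lambda>t. K +>\<^bsub>A\<^esub> g t))"
    by (simp add: fun_eq_iff huq_condition_def g_def case_prod_unfold)
  note L = least_morphism_ideal[OF g huq_domain_closed[OF I J]]
  show "huq_condition R A I J (huq_commutator R A I J)"
    unfolding huq_commutator_def eq by (rule L(1))
  show "huq_condition R A I J K \<Longrightarrow> huq_commutator R A I J \<subseteq> K"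
    unfolding huq_commutator_def eq by (rule L(2))
qed

end

end

theory Submission
  imports Defs
begin

text \<open>
  Both maps are linear, so only multiplicativity can fail modulo \<open>K\<close>. Writing
  \<open>x = y + p\<close> and \<open>z = y + q\<close> with \<open>p \<in> I\<close>, \<open>q \<in> J\<close>, the map is \<open>(x, y, z) \<mapsto> y + p + q\<close>, and
  its defect on a pair of triples is \<open>-(p q' + q p')\<close>; the Huq map is the case \<open>y = y' = 0\<close>.
  Hence both conditions on \<open>K\<close> say precisely that \<open>K\<close> contains all products \<open>ij\<close> and \<open>ji\<close>.
\<close>

context pre_lie_algebra
begin

text \<open>\<open>A\<close> is not a ring in the sense of the locale \<open>ring\<close>, so
  products with zero are computed from distributivity: 0 x = 0 x + 0 x, and cancellation in the
  additive group leaves 0 x = 0.\<close>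

lemma mult_l_zero: "x \<in> carrier A \<Longrightarrow> \<zero>\<^bsub>A\<^esub> \<otimes>\<^bsub>A\<^esub> x = \<zero>\<^bsub>A\<^esub>"
  using mult_l_distr[of "\<zero>\<^bsub>A\<^esub>" "\<zero>\<^bsub>A\<^esub>" x] mult_closed[of "\<zero>\<^bsub>A\<^esub>" x]
  by (metis M.add.l_cancel_one' M.r_zero M.zero_closed)

lemma mult_r_zero: "x \<in> carrier A \<Longrightarrow> x \<otimes>\<^bsub>A\<^esub> \<zero>\<^bsub>A\<^esub> = \<zero>\<^bsub>A\<^esub>"
  using mult_r_distr[of "\<zero>\<^bsub>A\<^esub>" "\<zero>\<^bsub>A\<^esub>" x] mult_closed[of x "\<zero>\<^bsub>A\<^esub>"]
  by (metis M.add.l_cancel_one' M.r_zero M.zero_closed)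

lemma minus_self: "x \<in> carrier A \<Longrightarrow> x \<ominus>\<^bsub>A\<^esub> x = \<zero>\<^bsub>A\<^esub>"
  by (simp add: a_minus_def M.r_neg)

lemma neg_zero: "\<ominus>\<^bsub>A\<^esub> \<zero>\<^bsub>A\<^esub> = \<zero>\<^bsub>A\<^esub>"
  using M.r_neg[OF M.zero_closed] by (simp add: M.a_inv_closed)

lemma add_minus_cancel_left:
  "\<lbrakk> x \<in> carrier A; y \<in> carrier A \<rbrakk> \<Longrightarrow> (x \<oplus>\<^bsub>A\<^esub> y) \<ominus>\<^bsub>A\<^esub> x = y"
  by (simp add: M.a_comm[of x y] M.minus_eq M.a_assoc M.r_neg)

lemma add_minus_cancel_right:
  "\<lbrakk> x \<in> carrier A; y \<in> carrier A \<rbrakk> \<Longrightarrow> x \<oplus>\<^bsub>A\<^esub> (y \<ominus>\<^bsub>A\<^esub> x) = y"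
  by (simp add: M.minus_eq M.a_lcomm[of x y] M.r_neg)

lemma minus_add_self:
  "\<lbrakk> x \<in> carrier A; y \<in> carrier A \<rbrakk> \<Longrightarrow> x \<ominus>\<^bsub>A\<^esub> (x \<oplus>\<^bsub>A\<^esub> y) = \<ominus>\<^bsub>A\<^esub> y"
  by (simp add: M.minus_eq M.minus_add M.r_neg2)

text \<open>Since x - y = p, the two images are p + z and p' + z'. Their product expands to pp' +
  pz' + zp' + zz', while the image of the product triple is pp' + py' + yp' + zz'. As z = y + q and
  z' = y' + q', the two differ exactly by the mixed terms pq' and qp'.\<close>

lemma smith_defect:
  assumes c: "y \<in> carrier A" "p \<in> carrier A" "q \<in> carrier A"
    "y' \<in> carrier A" "p' \<in> carrier A" "q' \<in> carrier A"
  defines "x \<equiv> y \<oplus>\<^bsub>A\<^esub> p" and "z \<equiv> y \<oplus>\<^bsub>A\<^esub> q" and "x' \<equiv> y' \<oplus>\<^bsub>A\<^esub> p'" and "z' \<equiv> y' \<oplus>\<^bsub>A\<^esub> q'"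
  shows "(x \<otimes>\<^bsub>A\<^esub> x' \<ominus>\<^bsub>A\<^esub> y \<otimes>\<^bsub>A\<^esub> y' \<oplus>\<^bsub>A\<^esub> z \<otimes>\<^bsub>A\<^esub> z') \<ominus>\<^bsub>A\<^esub>
      ((x \<ominus>\<^bsub>A\<^esub> y \<oplus>\<^bsub>A\<^esub> z) \<otimes>\<^bsub>A\<^esub> (x' \<ominus>\<^bsub>A\<^esub> y' \<oplus>\<^bsub>A\<^esub> z')) =
    \<ominus>\<^bsub>A\<^esub> (p \<otimes>\<^bsub>A\<^esub> q' \<oplus>\<^bsub>A\<^esub> q \<otimes>\<^bsub>A\<^esub> p')"
proof -
  have s: "x \<ominus>\<^bsub>A\<^esub> y = p" "x' \<ominus>\<^bsub>A\<^esub> y' = p'"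
    using c by (simp_all add: x_def x'_def add_minus_cancel_left)
  \<comment> \<open>The summand yy' is placed in front so that \<open>add_minus_cancel_left\<close>
    can remove it in \<open>d\<close>.\<close>
  have "x \<otimes>\<^bsub>A\<^esub> x' = y \<otimes>\<^bsub>A\<^esub> y' \<oplus>\<^bsub>A\<^esub> (y \<otimes>\<^bsub>A\<^esub> p' \<oplus>\<^bsub>A\<^esub> (p \<otimes>\<^bsub>A\<^esub> y' \<oplus>\<^bsub>A\<^esub> p \<otimes>\<^bsub>A\<^esub> p'))"
    using c by (simp add: x_def x'_def mult_l_distr mult_r_distr mult_closed M.a_ac)
  then have d: "x \<otimes>\<^bsub>A\<^esub> x' \<ominus>\<^bsub>A\<^esub> y \<otimes>\<^bsub>A\<^esub> y' = y \<otimes>\<^bsub>A\<^esub> p' \<oplus>\<^bsub>A\<^esub> (p \<otimes>\<^bsub>A\<^esub> y' \<oplus>\<^bsub>A\<^esub> p \<otimes>\<^bsub>A\<^esub> p')"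
    using c by (simp add: add_minus_cancel_left mult_closed)
  have "(x \<ominus>\<^bsub>A\<^esub> y \<oplus>\<^bsub>A\<^esub> z) \<otimes>\<^bsub>A\<^esub> (x' \<ominus>\<^bsub>A\<^esub> y' \<oplus>\<^bsub>A\<^esub> z') =
    (x \<otimes>\<^bsub>A\<^esub> x' \<ominus>\<^bsub>A\<^esub> y \<otimes>\<^bsub>A\<^esub> y' \<oplus>\<^bsub>A\<^esub> z \<otimes>\<^bsub>A\<^esub> z') \<oplus>\<^bsub>A\<^esub> (p \<otimes>\<^bsub>A\<^esub> q' \<oplus>\<^bsub>A\<^esub> q \<otimes>\<^bsub>A\<^esub> p')"
    unfolding s d using c by (simp add: z_def z'_def mult_l_distr mult_r_distr mult_closed M.a_ac)
  then show ?thesis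
    using c by (simp add: minus_add_self mult_closed x_def x'_def z_def z'_def)
qed

lemma huq_defect:
  assumes c: "p \<in> carrier A" "q \<in> carrier A" "p' \<in> carrier A" "q' \<in> carrier A"
  shows "(p \<otimes>\<^bsub>A\<^esub> p' \<oplus>\<^bsub>A\<^esub> q \<otimes>\<^bsub>A\<^esub> q') \<ominus>\<^bsub>A\<^esub> ((p \<oplus>\<^bsub>A\<^esub> q) \<otimes>\<^bsub>A\<^esub> (p' \<oplus>\<^bsub>A\<^esub> q')) =
    \<ominus>\<^bsub>A\<^esub> (p \<otimes>\<^bsub>A\<^esub> q' \<oplus>\<^bsub>A\<^esub> q \<otimes>\<^bsub>A\<^esub> p')"
  using smith_defect[of "\<zero>\<^bsub>A\<^esub>" p q "\<zero>\<^bsub>A\<^esub>" p' q'] c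
  by (simp add: mult_l_zero mult_closed M.minus_eq neg_zero)

text \<open>By \<open>morphism_quot_iff\<close> the morphism property amounts to three kinds of
  defect lying in \<open>K\<close>. The additive and scalar defects vanish in \<open>A\<close>
  itself, so everything rests on the multiplicative one.\<close>

lemma smith_condition_iff:
  assumes I: "pre_lie_ideal R A I" and J: "pre_lie_ideal R A J"
  shows "smith_condition R A I J K \<longleftrightarrow> pre_lie_ideal R A K \<and>
    (\<forall>i\<in>I. \<forall>j\<in>J. i \<otimes>\<^bsub>A\<^esub> j \<in> K \<and> j \<otimes>\<^bsub>A\<^esub> i \<in> K)"
\<comment> \<open>\<open>morphism_quot_iff\<close> requires an ideal; for any other \<open>K\<close>
  both sides are false by their first conjunct.\<close>
proof (cases "pre_lie_ideal R A K")
  case K: True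
  define D where "D = smith_domain A I J"
  define g where "g = (\<lambda>(x, y, z). (x \<ominus>\<^bsub>A\<^esub> y) \<oplus>\<^bsub>A\<^esub> z)"
  note sub = subsetD[OF ideal_subset[OF I]] subsetD[OF ideal_subset[OF J]]
  have g: "g \<in> carrier D \<rightarrow> carrier A"
    by (auto simp: g_def D_def smith_domain_def)
  have smith_eq: "smith_condition R A I J K \<longleftrightarrow>
      pre_lie_morphism R D (A /\<^sub>a K) (\<lambda>t. K +>\<^bsub>A\<^esub> g t)"
    by (simp add: K smith_condition_def g_def D_def case_prod_unfold)
  note iff = morphism_quot_iff[OF K g smith_domain_closed[OF I J, folded D_def]]
  show ?thesis
  proof
    assume "smith_condition R A I J K"
    then have m: "g (s \<otimes>\<^bsub>D\<^esub> t) \<ominus>\<^bsub>A\<^esub> (g s \<otimes>\<^bsub>A\<^esub> g t) \<in> K"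
      if "s \<in> carrier D" "t \<in> carrier D" for s t
      using that smith_eq iff by blast
    have "i \<otimes>\<^bsub>A\<^esub> j \<in> K \<and> j \<otimes>\<^bsub>A\<^esub> i \<in> K" if i: "i \<in> I" and j: "j \<in> J" for i j
    proof -
      have c: "i \<in> carrier A" "j \<in> carrier A" using i j sub by auto
      \<comment> \<open>These are the triples with y = 0 and (p, q) equal to (i, 0) and (0, j).
        Their product in either order is zero, while their images are i and j, so the two orders
        isolate the defects -(ij) and -(ji). Membership of the second triple uses -j in
        \<open>J\<close>.\<close>
      have st: "(i, \<zero>\<^bsub>A\<^esub>, \<zero>\<^bsub>A\<^esub>) \<in> carrier D" "(\<zero>\<^bsub>A\<^esub>, \<zero>\<^bsub>A\<^esub>, j) \<in> carrier D"
        using i j c ideal_zero[OF I] ideal_zero[OF J] ideal_closed(2)[OF J j]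
        by (auto simp: D_def smith_domain_def M.minus_eq neg_zero)
      have "\<ominus>\<^bsub>A\<^esub> (i \<otimes>\<^bsub>A\<^esub> j) \<in> K" "\<ominus>\<^bsub>A\<^esub> (j \<otimes>\<^bsub>A\<^esub> i) \<in> K"
        using m[OF st] m[OF st(2,1)] c
        by (simp_all add: g_def D_def smith_domain_def alg_prod_def M.minus_eq neg_zero
            mult_l_zero mult_r_zero mult_closed)
      then show ?thesis
        using c ideal_closed(2)[OF K] by (metis M.minus_minus mult_closed)
    qed
    with K show "pre_lie_ideal R A K \<and> (\<forall>i\<in>I. \<forall>j\<in>J. i \<otimes>\<^bsub>A\<^esub> j \<in> K \<and> j \<otimes>\<^bsub>A\<^esub> i \<in> K)"
      by blast
  next
    assume prods: "pre_lie_ideal R A K \<and> (\<forall>i\<in>I. \<forall>j\<in>J. i \<otimes>\<^bsub>A\<^esub> j \<in> K \<and> j \<otimes>\<^bsub>A\<^esub> i \<in> K)"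
    \<comment> \<open>The middle entry serves as a base point, with the outer entries displaced from
      it by elements of \<open>I\<close> and \<open>J\<close>. The congruence gives y - z in
      \<open>J\<close>, whereas q = z - y is wanted; closure under negation supplies it.\<close>
    have dom: "\<exists>y p q. t = (y \<oplus>\<^bsub>A\<^esub> p, y, y \<oplus>\<^bsub>A\<^esub> q) \<and> y \<in> carrier A \<and> p \<in> I \<and> q \<in> J"
      if tD: "t \<in> carrier D" for t
    proof -
      obtain x y z where t: "t = (x, y, z)" and c: "x \<in> carrier A" "y \<in> carrier A" "z \<in> carrier A"
        and d: "x \<ominus>\<^bsub>A\<^esub> y \<in> I" "y \<ominus>\<^bsub>A\<^esub> z \<in> J"
        using tD by (auto simp: D_def smith_domain_def)
      have "z \<ominus>\<^bsub>A\<^esub> y = \<ominus>\<^bsub>A\<^esub> (y \<ominus>\<^bsub>A\<^esub> z)"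
        using c by (simp add: M.minus_eq M.minus_add M.a_comm)
      then have "z \<ominus>\<^bsub>A\<^esub> y \<in> J" using ideal_closed(2)[OF J d(2)] by simp
      moreover have "x = y \<oplus>\<^bsub>A\<^esub> (x \<ominus>\<^bsub>A\<^esub> y)" "z = y \<oplus>\<^bsub>A\<^esub> (z \<ominus>\<^bsub>A\<^esub> y)"
        using c by (simp_all add: add_minus_cancel_right)
      ultimately show ?thesis using t c d by blast
    qed
    \<comment> \<open>The map is additive already before passing to the quotient, so this defect is
      zero; the same holds for scalars below.\<close>
    have add: "g (s \<oplus>\<^bsub>D\<^esub> t) \<ominus>\<^bsub>A\<^esub> (g s \<oplus>\<^bsub>A\<^esub> g t) \<in> K" if "s \<in> carrier D" "t \<in> carrier D" for s t
    proof -
      have "g (s \<oplus>\<^bsub>D\<^esub> t) = g s \<oplus>\<^bsub>A\<^esub> g t"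
        using that by (auto simp: g_def D_def smith_domain_def alg_prod_def M.minus_eq M.minus_add M.a_ac)
      moreover have "g s \<oplus>\<^bsub>A\<^esub> g t \<in> carrier A" using g that by auto
      ultimately show ?thesis by (simp add: minus_self ideal_zero[OF K])
    qed
    have smult: "g (a \<odot>\<^bsub>D\<^esub> t) \<ominus>\<^bsub>A\<^esub> (a \<odot>\<^bsub>A\<^esub> g t) \<in> K"
      if "a \<in> carrier R" "t \<in> carrier D" for a t
    proof -
      have "g (a \<odot>\<^bsub>D\<^esub> t) = a \<odot>\<^bsub>A\<^esub> g t"
        using that by (auto simp: g_def D_def smith_domain_def alg_prod_def M.minus_eq
            smult_r_distr smult_r_minus)
      moreover have "a \<odot>\<^bsub>A\<^esub> g t \<in> carrier A" using g that by auto
      ultimately show ?thesis by (simp add: minus_self ideal_zero[OF K])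
    qed
    have mult: "g (s \<otimes>\<^bsub>D\<^esub> t) \<ominus>\<^bsub>A\<^esub> (g s \<otimes>\<^bsub>A\<^esub> g t) \<in> K"
      if "s \<in> carrier D" "t \<in> carrier D" for s t
    proof -
      obtain y p q where s: "s = (y \<oplus>\<^bsub>A\<^esub> p, y, y \<oplus>\<^bsub>A\<^esub> q)" "y \<in> carrier A" "p \<in> I" "q \<in> J"
        using dom \<open>s \<in> carrier D\<close> by blast
      obtain y' p' q' where t: "t = (y' \<oplus>\<^bsub>A\<^esub> p', y', y' \<oplus>\<^bsub>A\<^esub> q')" "y' \<in> carrier A" "p' \<in> I" "q' \<in> J"
        using dom \<open>t \<in> carrier D\<close> by blast
      have "g (s \<otimes>\<^bsub>D\<^esub> t) \<ominus>\<^bsub>A\<^esub> (g s \<otimes>\<^bsub>A\<^esub> g t) = \<ominus>\<^bsub>A\<^esub> (p \<otimes>\<^bsub>A\<^esub> q' \<oplus>\<^bsub>A\<^esub> q \<otimes>\<^bsub>A\<^esub> p')"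
        using smith_defect[of y p q y' p' q'] s t sub
        by (simp add: g_def D_def smith_domain_def alg_prod_def)
      \<comment> \<open>In pq' the factor from \<open>I\<close> stands on the left, in qp' on the
        right; this is why \<open>K\<close> must contain the products in both orders.\<close>
      then show ?thesis
        using prods s t by (simp add: ideal_closed[OF K])
    qed
    show "smith_condition R A I J K"
      unfolding smith_eq
      by (rule iffD2[OF iff]) (assumption | intro conjI ballI add smult mult)+
  qed
qed (simp add: smith_condition_def)

text \<open>The right-hand side is literally that of \<open>smith_condition_iff\<close>, so the two
  commutators become least elements of the same family. The argument is the Smith one without a base
  point: a pair already consists of its displacements p and q.\<close>

lemma huq_condition_iff:
  assumes I: "pre_lie_ideal R A I" and J: "pre_lie_ideal R A J"
  shows "huq_condition R A I J K \<longleftrightarrow> pre_lie_ideal R A K \<and>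
    (\<forall>i\<in>I. \<forall>j\<in>J. i \<otimes>\<^bsub>A\<^esub> j \<in> K \<and> j \<otimes>\<^bsub>A\<^esub> i \<in> K)"
proof (cases "pre_lie_ideal R A K")
  case K: True
  define D where "D = A\<lparr>carrier := I\<rparr> \<times>\<^sub>a A\<lparr>carrier := J\<rparr>"
  define g where "g = (\<lambda>(i, j). i \<oplus>\<^bsub>A\<^esub> j)"
  note sub = subsetD[OF ideal_subset[OF I]] subsetD[OF ideal_subset[OF J]]
  have g: "g \<in> carrier D \<rightarrow> carrier A"
    using sub by (auto simp: g_def D_def alg_prod_def)
  have huq_eq: "huq_condition R A I J K \<longleftrightarrow>
      pre_lie_morphism R D (A /\<^sub>a K) (\<lambda>t. K +>\<^bsub>A\<^esub> g t)"
    by (simp add: K huq_condition_def g_def D_def case_prod_unfold)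
  note iff = morphism_quot_iff[OF K g huq_domain_closed[OF I J, folded D_def]]
  show ?thesis
  proof
    assume "huq_condition R A I J K"
    then have m: "g (s \<otimes>\<^bsub>D\<^esub> t) \<ominus>\<^bsub>A\<^esub> (g s \<otimes>\<^bsub>A\<^esub> g t) \<in> K"
      if "s \<in> carrier D" "t \<in> carrier D" for s t
      using that huq_eq iff by blast
    have "i \<otimes>\<^bsub>A\<^esub> j \<in> K \<and> j \<otimes>\<^bsub>A\<^esub> i \<in> K" if i: "i \<in> I" and j: "j \<in> J" for i j
    proof -
      have c: "i \<in> carrier A" "j \<in> carrier A" using i j sub by auto
      \<comment> \<open>As for triples, the two pairs multiply to zero in both orders and map to i
        and j.\<close>
      have st: "(i, \<zero>\<^bsub>A\<^esub>) \<in> carrier D" "(\<zero>\<^bsub>A\<^esub>, j) \<in> carrier D"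
        using i j ideal_zero[OF I] ideal_zero[OF J] by (auto simp: D_def alg_prod_def)
      have "\<ominus>\<^bsub>A\<^esub> (i \<otimes>\<^bsub>A\<^esub> j) \<in> K" "\<ominus>\<^bsub>A\<^esub> (j \<otimes>\<^bsub>A\<^esub> i) \<in> K"
        using m[OF st] m[OF st(2,1)] c
        by (simp_all add: g_def D_def alg_prod_def M.minus_eq mult_l_zero mult_r_zero mult_closed)
      then show ?thesis
        using c ideal_closed(2)[OF K] by (metis M.minus_minus mult_closed)
    qed
    with K show "pre_lie_ideal R A K \<and> (\<forall>i\<in>I. \<forall>j\<in>J. i \<otimes>\<^bsub>A\<^esub> j \<in> K \<and> j \<otimes>\<^bsub>A\<^esub> i \<in> K)"
      by blast
  next
    assume prods: "pre_lie_ideal R A K \<and> (\<forall>i\<in>I. \<forall>j\<in>J. i \<otimes>\<^bsub>A\<^esub> j \<in> K \<and> j \<otimes>\<^bsub>A\<^esub> i \<in> K)"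
    have add: "g (s \<oplus>\<^bsub>D\<^esub> t) \<ominus>\<^bsub>A\<^esub> (g s \<oplus>\<^bsub>A\<^esub> g t) \<in> K" if "s \<in> carrier D" "t \<in> carrier D" for s t
    proof -
      have "g (s \<oplus>\<^bsub>D\<^esub> t) = g s \<oplus>\<^bsub>A\<^esub> g t"
        using that sub by (auto simp: g_def D_def alg_prod_def M.a_ac)
      moreover have "g s \<oplus>\<^bsub>A\<^esub> g t \<in> carrier A" using g that by auto
      ultimately show ?thesis by (simp add: minus_self ideal_zero[OF K])
    qed
    have smult: "g (a \<odot>\<^bsub>D\<^esub> t) \<ominus>\<^bsub>A\<^esub> (a \<odot>\<^bsub>A\<^esub> g t) \<in> K"
      if "a \<in> carrier R" "t \<in> carrier D" for a t
    proof -
      have "g (a \<odot>\<^bsub>D\<^esub> t) = a \<odot>\<^bsub>A\<^esub> g t"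
        using that sub by (auto simp: g_def D_def alg_prod_def smult_r_distr)
      moreover have "a \<odot>\<^bsub>A\<^esub> g t \<in> carrier A" using g that by auto
      ultimately show ?thesis by (simp add: minus_self ideal_zero[OF K])
    qed
    have mult: "g (s \<otimes>\<^bsub>D\<^esub> t) \<ominus>\<^bsub>A\<^esub> (g s \<otimes>\<^bsub>A\<^esub> g t) \<in> K"
      if "s \<in> carrier D" "t \<in> carrier D" for s t
      using that prods sub
      by (auto simp: g_def D_def alg_prod_def huq_defect ideal_closed[OF K])
    show "huq_condition R A I J K"
      unfolding huq_eq
      by (rule iffD2[OF iff]) (assumption | intro conjI ballI add smult mult)+
  qed
qed (simp add: huq_condition_def)

text \<open>The inclusion in \<open>carrier A\<close> makes the whole algebra a member of the
  intersected family, which is therefore nonempty as \<open>Inter_ideal\<close> demands.\<close>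

lemma ideal_generated_ideal:
  assumes "S \<subseteq> carrier A"
  shows "pre_lie_ideal R A (ideal_generated R A S)"
  unfolding ideal_generated_def
  by (rule Inter_ideal) (use assms carrier_ideal in auto)

text \<open>This links the \<open>LEAST\<close> form of the commutators to the intersection form of
  generated ideals: the intersection belongs to the family and lies below each member.\<close>

lemma Least_ideal_containing:
  assumes "S \<subseteq> carrier A"
  shows "(LEAST K. pre_lie_ideal R A K \<and> S \<subseteq> K) = ideal_generated R A S"
  by (rule Least_equality)
    (use ideal_generated_ideal[OF assms] in \<open>auto simp: ideal_generated_def\<close>)

end

theorem theorem11:
  fixes R :: "('k, 'r) ring_scheme"
    and A :: "('k, 'a, 'm) module_scheme"
    and I J :: "'a set"
  assumes "pre_lie_algebra R A"
    and "pre_lie_ideal R A I"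
    and "pre_lie_ideal R A J"
  shows "smith_commutator R A I J =
      ideal_generated R A ({i \<otimes>\<^bsub>A\<^esub> j | i j. i \<in> I \<and> j \<in> J} \<union> {j \<otimes>\<^bsub>A\<^esub> i | i j. i \<in> I \<and> j \<in> J})
    \<and> huq_commutator R A I J = smith_commutator R A I J"
proof -
  interpret pre_lie_algebra R A by fact
  note I = assms(2) and J = assms(3)
  let ?S = "{i \<otimes>\<^bsub>A\<^esub> j | i j. i \<in> I \<and> j \<in> J} \<union> {j \<otimes>\<^bsub>A\<^esub> i | i j. i \<in> I \<and> j \<in> J}"
  have S: "?S \<subseteq> carrier A"
    using ideal_subset[OF I] ideal_subset[OF J] mult_closed by blast
  \<comment> \<open>Rewriting the pointwise condition as an inclusion brings both commutators to the
    shape of \<open>Least_ideal_containing\<close>.\<close>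
  have prods: "(\<forall>i\<in>I. \<forall>j\<in>J. i \<otimes>\<^bsub>A\<^esub> j \<in> K \<and> j \<otimes>\<^bsub>A\<^esub> i \<in> K) \<longleftrightarrow> ?S \<subseteq> K" for K
    by blast
  show ?thesis
    unfolding smith_commutator_def huq_commutator_def smith_condition_iff[OF I J]
      huq_condition_iff[OF I J] prods Least_ideal_containing[OF S]
    by simp
qed

end
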